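(* For every integer $n\ge 2$, the presentation $\langle x,y \mid x^n=y^{n+1},\ xyx=yxy\rangle$ is AC-equivalent to the presentation $\langle x,y \mid x^{-1}y^nx=y^{n+1},\ x=y^{-1}x^{-1}yxy\rangle$.
   Context: Let $F$ be the free group on $\{x,y\}$. For a tuple $Y=(y_1,\dots,y_m)$ of elements of $F$, consider the elementary transformations: (AC1) replace $y_i$ by $y_iy_j$ for some $j\ne i$; (AC2) replace $y_i$ by $y_i^{-1}$; (AC3) replace $y_i$ by $g y_i g^{-1}$ for some $g\in F$; in each case all other entries are unchanged. Two tuples are AC-equivalent if one can be obtained from the other by a finite sequence of transformations (AC1)-(AC3). Two presentations on the same generators are AC-equivalent if their tuples of relators, viewed as elements of the free group on the generators, are AC-equivalent. A relation $u=v$ in a presentation stands for the relator $uv^{-1}$. *)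

theory Defs
  imports "HOL-Algebra.Group"
begin

(* Free group on a type 'a of generators: words in letters (a, True), standing for a,
   and (a, False), standing for the inverse of a, modulo insertion and deletion of
   adjacent mutually inverse letters. *)

inductive cancel :: "('a \<times> bool) list \<Rightarrow> ('a \<times> bool) list \<Rightarrow> bool" where
  "cancel (u @ [(a, b), (a, \<not> b)] @ v) (u @ v)"

quotient_type 'a free_group = "('a \<times> bool) list" / "equivclp cancel"
  by (rule equivp_evquivclp)

lemma cancel_append_left: "cancel u v \<Longrightarrow> cancel (w @ u) (w @ v)"
  by (induction rule: cancel.induct) (metis append.assoc cancel.intros)

lemma cancel_append_right: "cancel u v \<Longrightarrow> cancel (u @ w) (v @ w)"
  by (induction rule: cancel.induct) (metis append.assoc cancel.intros)

lemma equivclp_cancel_append: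
  assumes "equivclp cancel u u'" "equivclp cancel v v'"
  shows "equivclp cancel (u @ v) (u' @ v')"
proof -
  have "equivclp cancel (u @ v) (u' @ v)"
    using assms(1)
    by (induction rule: equivclp_induct)
      (auto intro: equivclp_into_equivclp cancel_append_right)
  also have "equivclp cancel (u' @ v) (u' @ v')"
    using assms(2)
    by (induction rule: equivclp_induct)
      (auto intro: equivclp_into_equivclp cancel_append_left)
  finally (equivclp_trans) show ?thesis .
qed

lift_definition free_one :: "'a free_group" is "[]" .

lift_definition free_mult :: "'a free_group \<Rightarrow> 'a free_group \<Rightarrow> 'a free_group" is "(@)"
  by (rule equivclp_cancel_append)

lift_definition free_gen :: "'a \<Rightarrow> 'a free_group" is "\<lambda>a. [(a, True)]" .

definition free_group :: "'a free_group monoid" where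
  "free_group = \<lparr>carrier = UNIV, mult = free_mult, one = free_one\<rparr>"

lemma cancel_inverse_word:
  "equivclp cancel (rev (map (\<lambda>(a, b). (a, \<not> b)) w) @ w) []"
proof (induction w)
  case Nil
  show ?case by simp
next
  case (Cons p w)
  obtain a b where p: "p = (a, b)" by fastforce
  let ?r = "rev (map (\<lambda>(a, b). (a, \<not> b)) w)"
  have "cancel (?r @ [(a, \<not> b), (a, \<not> \<not> b)] @ w) (?r @ w)"
    by (rule cancel.intros)
  then have "equivclp cancel (rev (map (\<lambda>(a, b). (a, \<not> b)) (p # w)) @ p # w) (?r @ w)"
    by (auto simp: p)
  then show ?case using Cons.IH by (rule equivclp_trans)
qed

lemma group_free_group: "group free_group"
proof (rule groupI)
  fix x y z :: "'a free_group"
  show "x \<otimes>\<^bsub>free_group\<^esub> y \<otimes>\<^bsub>free_group\<^esub> z = x \<otimes>\<^bsub>free_group\<^esub> (y \<otimes>\<^bsub>free_group\<^esub> z)"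
    unfolding free_group_def by simp (transfer, simp)
  show "\<one>\<^bsub>free_group\<^esub> \<otimes>\<^bsub>free_group\<^esub> x = x"
    unfolding free_group_def by simp (transfer, simp)
  have "\<exists>y. free_mult y x = free_one"
    by transfer (blast intro: cancel_inverse_word)
  then show "\<exists>y\<in>carrier free_group. y \<otimes>\<^bsub>free_group\<^esub> x = \<one>\<^bsub>free_group\<^esub>"
    by (simp add: free_group_def)
qed (simp_all add: free_group_def)

inductive AC_step :: "('a, 'b) monoid_scheme \<Rightarrow> 'a list \<Rightarrow> 'a list \<Rightarrow> bool"
  for G (structure) where
  AC1: "\<lbrakk>i < length Y; j < length Y; j \<noteq> i\<rbrakk> \<Longrightarrow> AC_step G Y (Y[i := Y ! i \<otimes> Y ! j])"
| AC2: "i < length Y \<Longrightarrow> AC_step G Y (Y[i := inv (Y ! i)])"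
| AC3: "\<lbrakk>i < length Y; g \<in> carrier G\<rbrakk> \<Longrightarrow> AC_step G Y (Y[i := g \<otimes> Y ! i \<otimes> inv g])"

(* Every step can be undone by finitely many steps (in a group, for tuples of elements of
   its carrier), so the symmetric closure is not needed. *)
definition AC_equivalent :: "('a, 'b) monoid_scheme \<Rightarrow> 'a list \<Rightarrow> 'a list \<Rightarrow> bool" where
  "AC_equivalent G = (AC_step G)\<^sup>*\<^sup>*"

definition relator :: "('a, 'b) monoid_scheme \<Rightarrow> 'a \<Rightarrow> 'a \<Rightarrow> 'a" where
  "relator G u v = u \<otimes>\<^bsub>G\<^esub> inv\<^bsub>G\<^esub> v"

datatype generator = Gen_x | Gen_y

end

theory Submission
  imports Defs
begin

(* Write r for the relator of xyx = yxy and c = xy. Then c x = r y c in the free group, so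
   conjugating x^n = y^(n+1) by c turns x^n into (r y)^n, from which the factors r can be
   removed because r is the other relator. Conjugating by x^(-1) gives the first new relator;
   the second one is a conjugate of r. *)

context group
begin

text \<open>Once \<open>m_assoc\<close> has bracketed a word to the right, \<open>inv a\<close> and
  a following \<open>a\<close> no longer form a subterm unless they end the word; this law and the
  next one cancel them in mid-word.\<close>

lemma inv_mult_cancel_left:
  "\<lbrakk>a \<in> carrier G; b \<in> carrier G\<rbrakk> \<Longrightarrow> inv a \<otimes> (a \<otimes> b) = b"
  by (simp flip: m_assoc)

lemma mult_inv_cancel_left:
  "\<lbrakk>a \<in> carrier G; b \<in> carrier G\<rbrakk> \<Longrightarrow> a \<otimes> (inv a \<otimes> b) = b"
  by (simp flip: m_assoc)

lemmas word_simps = m_assoc inv_mult_group inv_mult_cancel_left mult_inv_cancel_left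

lemma nat_pow_conj:
  assumes "c \<in> carrier G" "a \<in> carrier G"
  shows "(c \<otimes> a \<otimes> inv c) [^] (n::nat) = c \<otimes> a [^] n \<otimes> inv c"
  using assms by (induction n) (simp_all add: word_simps)

lemma AC_equivalent_trans [trans]:
  "\<lbrakk>AC_equivalent G X Y; AC_equivalent G Y Z\<rbrakk> \<Longrightarrow> AC_equivalent G X Z"
  unfolding AC_equivalent_def by (rule rtranclp_trans)

lemma AC_conj_fst:
  "g \<in> carrier G \<Longrightarrow> AC_equivalent G [a, b] [g \<otimes> a \<otimes> inv g, b]"
  using AC3[of 0 "[a, b]" g G] by (simp add: AC_equivalent_def r_into_rtranclp)

lemma AC_conj_snd:
  "g \<in> carrier G \<Longrightarrow> AC_equivalent G [a, b] [a, g \<otimes> b \<otimes> inv g]"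
  using AC3[of 1 "[a, b]" g G] by (simp add: AC_equivalent_def r_into_rtranclp)

lemma AC_inv_snd: "AC_equivalent G [a, b] [a, inv b]"
  using AC2[of 1 "[a, b]" G] by (simp add: AC_equivalent_def r_into_rtranclp)

lemma AC_mult_fst: "AC_equivalent G [a, b] [a \<otimes> b, b]"
  using AC1[of 0 "[a, b]" 1 G] by (simp add: AC_equivalent_def r_into_rtranclp)

text \<open>Invert the second entry, multiply it into the first, and invert it back.\<close>

lemma AC_mult_inv_fst:
  assumes "b \<in> carrier G"
  shows "AC_equivalent G [a, b] [a \<otimes> inv b, b]"
proof -
  have "AC_equivalent G [a, b] [a, inv b]"
    by (rule AC_inv_snd)
  also have "AC_equivalent G \<dots> [a \<otimes> inv b, inv b]"
    by (rule AC_mult_fst)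
  also have "AC_equivalent G \<dots> [a \<otimes> inv b, inv (inv b)]"
    by (rule AC_inv_snd)
  finally show ?thesis using assms by simp
qed

text \<open>Conjugation by \<open>b\<close> rotates the word to
  \<open>b \<otimes> a \<otimes> r\<close>; there \<open>r\<close> stands last and can be cancelled
  by the second entry. Conjugation by \<open>inv b\<close> undoes the rotation.\<close>

lemma AC_remove_relator:
  assumes [simp]: "a \<in> carrier G" "r \<in> carrier G" "b \<in> carrier G"
  shows "AC_equivalent G [a \<otimes> r \<otimes> b, r] [a \<otimes> b, r]"
proof -
  have "AC_equivalent G [a \<otimes> r \<otimes> b, r] [b \<otimes> (a \<otimes> r \<otimes> b) \<otimes> inv b, r]"
    by (simp add: AC_conj_fst)
  also have "AC_equivalent G \<dots> [b \<otimes> (a \<otimes> r \<otimes> b) \<otimes> inv b \<otimes> inv r, r]"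
    by (simp add: AC_mult_inv_fst)
  also have "b \<otimes> (a \<otimes> r \<otimes> b) \<otimes> inv b \<otimes> inv r = b \<otimes> a"
    by (simp add: word_simps)
  also have "AC_equivalent G [b \<otimes> a, r] [inv b \<otimes> (b \<otimes> a) \<otimes> inv (inv b), r]"
    by (rule AC_conj_fst) simp
  also have "inv b \<otimes> (b \<otimes> a) \<otimes> inv (inv b) = a \<otimes> b"
    by (simp add: word_simps)
  finally show ?thesis .
qed

text \<open>Induction removes the copies of \<open>r\<close> from right to left. The tail
  \<open>b\<close> is arbitrary because each freed \<open>y\<close> is absorbed into it.\<close>

lemma AC_remove_relator_pow:
  assumes [simp]: "r \<in> carrier G" "y \<in> carrier G" and "b \<in> carrier G"
  shows "AC_equivalent G [(r \<otimes> y) [^] (n::nat) \<otimes> b, r] [y [^] n \<otimes> b, r]"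
  using \<open>b \<in> carrier G\<close>
proof (induction n arbitrary: b)
  case 0
  show ?case by (simp add: AC_equivalent_def)
next
  case (Suc n)
  note [simp] = \<open>b \<in> carrier G\<close>
  have "(r \<otimes> y) [^] Suc n \<otimes> b = (r \<otimes> y) [^] n \<otimes> r \<otimes> (y \<otimes> b)"
    by (simp add: m_assoc)
  also have "AC_equivalent G [\<dots>, r] [(r \<otimes> y) [^] n \<otimes> (y \<otimes> b), r]"
    by (simp add: AC_remove_relator)
  also have "AC_equivalent G \<dots> [y [^] n \<otimes> (y \<otimes> b), r]"
    by (simp add: Suc.IH)
  finally show ?case by (simp add: m_assoc)
qed

text \<open>The computation is the same in every group. The exponents \<open>m\<close> and
  \<open>n\<close> are independent: of \<open>y [^] m\<close> it uses only that it commutes with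
  \<open>y\<close>.\<close>

lemma AC_braid_presentation:
  fixes m n :: nat
  assumes [simp]: "x \<in> carrier G" "y \<in> carrier G"
  shows "AC_equivalent G
    [relator G (x [^] n) (y [^] m), relator G (x \<otimes> y \<otimes> x) (y \<otimes> x \<otimes> y)]
    [relator G (inv x \<otimes> y [^] n \<otimes> x) (y [^] m),
     relator G x (inv y \<otimes> inv x \<otimes> y \<otimes> x \<otimes> y)]"
proof -
  define r c p where "r = relator G (x \<otimes> y \<otimes> x) (y \<otimes> x \<otimes> y)"
    and "c = x \<otimes> y" and "p = inv (y [^] m)"
  have [simp]: "r \<in> carrier G" "c \<in> carrier G" "p \<in> carrier G"
    by (simp_all add: r_def c_def p_def relator_def)
  have "c \<otimes> x \<otimes> inv c = r \<otimes> y"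
    by (simp add: r_def c_def relator_def word_simps)
  then have pow: "c \<otimes> x [^] n \<otimes> inv c = (r \<otimes> y) [^] n"
    using nat_pow_conj[of c x n] by simp
  have comm: "y \<otimes> p = p \<otimes> y"
  proof -
    have "y [^] m \<otimes> y = y \<otimes> y [^] m"
      by (metis assms(2) nat_pow_Suc nat_pow_Suc2)
    then show ?thesis
      by (metis assms(2) inv_closed inv_solve_left inv_solve_right m_assoc m_closed
          nat_pow_closed p_def)
  qed
  have "AC_equivalent G [relator G (x [^] n) (y [^] m), r] [c \<otimes> (x [^] n \<otimes> p) \<otimes> inv c, r]"
    by (simp add: AC_conj_fst relator_def p_def)
  \<comment> \<open>Conjugation acts on both factors; the conjugate of \<open>p\<close> becomes the
    tail from which the removal of \<open>r\<close> starts.\<close>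
  also have "c \<otimes> (x [^] n \<otimes> p) \<otimes> inv c = (r \<otimes> y) [^] n \<otimes> (c \<otimes> p \<otimes> inv c)"
    by (simp add: word_simps flip: pow)
  also have "AC_equivalent G [\<dots>, r] [y [^] n \<otimes> (c \<otimes> p \<otimes> inv c), r]"
    by (simp add: AC_remove_relator_pow)
  \<comment> \<open>The word ends in \<open>inv c\<close>, that is
    \<open>inv y \<otimes> inv x\<close>, so this conjugation cancels its last letter. What remains
    after \<open>x\<close> is \<open>y \<otimes> p \<otimes> inv y\<close>, which equals
    \<open>p\<close> by \<open>comm\<close>.\<close>
  also have "AC_equivalent G \<dots> [inv x \<otimes> (y [^] n \<otimes> (c \<otimes> p \<otimes> inv c)) \<otimes> inv (inv x), r]"
    by (rule AC_conj_fst) simp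
  also have "inv x \<otimes> (y [^] n \<otimes> (c \<otimes> p \<otimes> inv c)) \<otimes> inv (inv x)
      = inv x \<otimes> y [^] n \<otimes> x \<otimes> (y \<otimes> p) \<otimes> inv y"
    by (simp add: c_def word_simps)
  also have "\<dots> = relator G (inv x \<otimes> y [^] n \<otimes> x) (y [^] m)"
    unfolding comm by (simp add: relator_def p_def word_simps)
  \<comment> \<open>The word \<open>r\<close> begins with \<open>x \<otimes> y\<close>, so
    conjugating by \<open>inv c\<close> moves this prefix to its end.\<close>
  also have "AC_equivalent G [\<dots>, r]
      [relator G (inv x \<otimes> y [^] n \<otimes> x) (y [^] m), inv c \<otimes> r \<otimes> inv (inv c)]"
    by (rule AC_conj_snd) simp
  also have "inv c \<otimes> r \<otimes> inv (inv c) = relator G x (inv y \<otimes> inv x \<otimes> y \<otimes> x \<otimes> y)"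
    by (simp add: c_def r_def relator_def word_simps)
  finally show ?thesis by (simp add: r_def)
qed

end

theorem proposition1p3:
  fixes F :: "generator free_group monoid" (structure)
    and x y :: "generator free_group"
    and n :: nat
  assumes "F = free_group" and "x = free_gen Gen_x" and "y = free_gen Gen_y"
    and "n \<ge> 2"
  shows "AC_equivalent F
    [relator F (x [^] n) (y [^] (n + 1)),
     relator F (x \<otimes> y \<otimes> x) (y \<otimes> x \<otimes> y)]
    [relator F (inv x \<otimes> y [^] n \<otimes> x) (y [^] (n + 1)),
     relator F x (inv y \<otimes> inv x \<otimes> y \<otimes> x \<otimes> y)]"
proof -
  interpret group F
    unfolding \<open>F = free_group\<close> by (rule group_free_group)
  have "carrier F = UNIV"
    by (simp add: \<open>F = free_group\<close> free_group_def)
  \<comment> \<open>This is the case \<open>m = n + 1\<close>.\<close>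
  then show ?thesis
    by (intro AC_braid_presentation) simp_all
qed

end
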